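(* Let $\ell\in\mathbb N=\{1,2,3,\dots\}$ and let $\eta\in[0,1]$ be the parameter of the traffic-majority rule $\phi_\eta$. Let $(A_1,A_2)$ be the random-walk approximation with block length $\ell$, and let $s_{A_2}$ be the stopping time of $A_2$, i.e. the approximated classification time for the initial configuration $\mathcal B(n,\ell)$ (a block of $\ell$ cells in state 1). Then the generating function $G_{II}(\ell,s)=\sum_{k\ge0}\mathbf P(s_{A_2}=k)\,s^k$ of the approximated classification time is $$G_{II}(\ell,s)=F_{-1}\!\left(\eta,\sqrt{H(1-\eta,s)}\right)^{\ell-1}\,\left(\sqrt{H(1-\eta,s)}\right)^{\ell+1},$$ where $F_{-1}(p,s)$ is the generating function of the first time at which a $p$-walk starting from $1$ reaches $0$, and $H(p,s)$ is the generating function of the end time of a $p$-walk that ends after its first step to the left; these are given by $$F_{-1}(p,s)=\frac{1-\sqrt{1-4p(1-p)s^2}}{2ps},\qquad H(p,s)=\frac{(1-p)s}{1-ps}.$$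
   Context: The traffic-majority rule $\phi_\eta$ is the two-state stochastic cellular automaton rule of radius 1 in which a cell with left neighbour, own state and right neighbour $(a,b,c)$ is in state 1 at the next time step, independently of the other cells, with probability $\phi_\eta(a,b,c)$, where $\phi_\eta(0,0,0)=\phi_\eta(0,0,1)=\phi_\eta(0,1,0)=0$, $\phi_\eta(1,0,1)=\phi_\eta(1,1,1)=\phi_\eta(0,1,1)=1$, $\phi_\eta(1,0,0)=1-\eta$, $\phi_\eta(1,1,0)=\eta$. The configuration $\mathcal B(n,\ell)$ on the ring $\mathbb Z/n\mathbb Z$ has state 1 exactly at the locations $0,\dots,\ell-1$. The classification time (for blocks that are in the minority) is the first time at which all cells are in state 0. It is approximated by the following random-walk model, which does not depend on $n$. A $p$-walk ($p\in[0,1]$) is a random walk on $\mathbb Z$ in which each step is $+1$ with probability $p$ and $-1$ with probability $1-p$, up to a (possibly infinite) stopping time. The random-walk approximation with block length $\ell$ is a pair $(A_1,A_2)$ of independent walks (independent apart from the stopping rule of $A_2$), both starting at $\ell-1$ at time $t=0$: - $A_1$ is an $\eta$-walk that ends at $s_{A_1}$, the first time $t$ with $A_{1,t}=0$. - $A_2$ is a $(1-\eta)$-walk that ends at $s_{A_2}$, the first time $t$ with $t-A_{2,t}=s_{A_1}+2$. A stopping time is $\infty$ if no such time exists. *)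

theory Defs
  imports "HOL-Probability.Probability"
begin

text \<open>
  A walk is represented by its whole (unstopped) trajectory, and ``ending'' at a stopping time
  is expressed by a first time with values in \<^typ>\<open>enat\<close>.
\<close>

definition p_walk :: "'a measure \<Rightarrow> real \<Rightarrow> int \<Rightarrow> (nat \<Rightarrow> 'a \<Rightarrow> int) \<Rightarrow> bool" where
  "p_walk M p x X \<longleftrightarrow>
     prob_space M \<and>
     (\<forall>t. X t \<in> measurable M (count_space UNIV)) \<and>
     (\<forall>\<omega>\<in>space M. X 0 \<omega> = x) \<and>
     prob_space.indep_vars M (\<lambda>_. count_space UNIV) (\<lambda>t \<omega>. X (Suc t) \<omega> - X t \<omega>) UNIV \<and>
     (\<forall>t. \<P>(\<omega> in M. X (Suc t) \<omega> - X t \<omega> = 1) = p \<and>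
          \<P>(\<omega> in M. X (Suc t) \<omega> - X t \<omega> = -1) = 1 - p)"

text \<open>The infimum of the empty set in \<^typ>\<open>enat\<close> is \<open>\<infinity>\<close>.\<close>

definition first_time :: "(nat \<Rightarrow> bool) \<Rightarrow> enat" where
  "first_time P = Inf (enat ` {t. P t})"

definition prob_gf :: "'a measure \<Rightarrow> ('a \<Rightarrow> enat) \<Rightarrow> complex \<Rightarrow> complex" where
  "prob_gf M T s = (\<Sum>k. complex_of_real (\<P>(\<omega> in M. T \<omega> = enat k)) * s ^ k)"

definition hit_time :: "int \<Rightarrow> (nat \<Rightarrow> 'a \<Rightarrow> int) \<Rightarrow> 'a \<Rightarrow> enat" where
  "hit_time y X \<omega> = first_time (\<lambda>t. X t \<omega> = y)"

definition first_left_time :: "(nat \<Rightarrow> 'a \<Rightarrow> int) \<Rightarrow> 'a \<Rightarrow> enat" where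
  "first_left_time X \<omega> = first_time (\<lambda>t. 0 < t \<and> X t \<omega> = X (t - 1) \<omega> - 1)"


subsection \<open>The canonical walk and its generating functions\<close>

definition step_pmf :: "real \<Rightarrow> int pmf" where
  "step_pmf p = map_pmf (\<lambda>b. if b then 1 else -1) (bernoulli_pmf p)"

definition steps_space :: "real \<Rightarrow> (nat \<Rightarrow> int) measure" where
  "steps_space p = (\<Pi>\<^sub>M i\<in>UNIV. measure_pmf (step_pmf p))"

definition walk_from :: "int \<Rightarrow> nat \<Rightarrow> (nat \<Rightarrow> int) \<Rightarrow> int" where
  "walk_from x t \<omega> = x + (\<Sum>i<t. \<omega> i)"

text \<open>
  The closed form \<open>(1 - csqrt (1 - 4 * p * (1 - p) * s\<^sup>2)) / (2 * p * s)\<close> of the first function is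
  \<open>0/0\<close> at \<open>p * s = 0\<close>; its limit there is \<open>(1 - p) * s = s\<close>, which is what the series gives.
  The closed form \<open>(1 - p) * s / (1 - p * s)\<close> of the second one is \<open>0/0\<close> at \<open>p = s = 1\<close>; the series
  is then \<open>0\<close>, as the walk never steps to the left, and so is the quotient in HOL.
\<close>

definition F_minus1 :: "real \<Rightarrow> complex \<Rightarrow> complex" where
  "F_minus1 p s = prob_gf (steps_space p) (hit_time 0 (walk_from 1)) s"

definition H_left :: "real \<Rightarrow> complex \<Rightarrow> complex" where
  "H_left p s = prob_gf (steps_space p) (first_left_time (walk_from 0)) s"

lemma prob_space_steps_space: "prob_space (steps_space p)"
  unfolding steps_space_def by (intro prob_space_PiM measure_pmf.prob_space_axioms)

lemma measurable_steps_component [measurable]: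
  "(\<lambda>\<omega>. \<omega> i) \<in> measurable (steps_space p) (count_space UNIV)"
proof -
  have "(\<lambda>\<omega>. \<omega> i) \<in> measurable (steps_space p) (measure_pmf (step_pmf p))"
    unfolding steps_space_def by (rule measurable_component_singleton) simp
  then show ?thesis
    by (simp cong: measurable_cong_sets)
qed

lemma distr_steps_component:
  "distr (steps_space p) (count_space UNIV) (\<lambda>\<omega>. \<omega> i) = measure_pmf (step_pmf p)"
proof -
  have "distr (steps_space p) (measure_pmf (step_pmf p)) (\<lambda>\<omega>. \<omega> i) = measure_pmf (step_pmf p)"
    unfolding steps_space_def
    by (rule distr_PiM_component) (auto intro: measure_pmf.prob_space_axioms)
  then show ?thesis
    by (metis distr_cong sets_measure_pmf_count_space)
qed

lemma indep_vars_steps: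
  "prob_space.indep_vars (steps_space p) (\<lambda>_. count_space UNIV) (\<lambda>i \<omega>. \<omega> i) UNIV"
proof -
  interpret prob_space "steps_space p" by (rule prob_space_steps_space)
  have sets: "sets (\<Pi>\<^sub>M i\<in>(UNIV::nat set). count_space (UNIV::int set)) = sets (steps_space p)"
    unfolding steps_space_def by (intro sets_PiM_cong) auto
  show ?thesis
    by (subst indep_vars_iff_distr_eq_PiM)
       (simp_all add: distr_steps_component restrict_UNIV distr_id2[OF sets] flip: steps_space_def)
qed

lemma prob_steps:
  "\<P>(\<omega> in steps_space p. \<omega> i = k) = pmf (step_pmf p) k"
proof -
  have "pmf (step_pmf p) k = measure (distr (steps_space p) (count_space UNIV) (\<lambda>\<omega>. \<omega> i)) {k}"
    by (simp add: distr_steps_component measure_pmf_single)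
  also have "\<dots> = \<P>(\<omega> in steps_space p. \<omega> i = k)"
    by (subst measure_distr) (auto intro!: arg_cong[where f = "measure _"])
  finally show ?thesis ..
qed

lemma measurable_walk_from [measurable]:
  "walk_from x t \<in> measurable (steps_space p) (count_space UNIV)"
proof (induction t)
  case 0
  then show ?case by (simp add: walk_from_def)
next
  case (Suc t)
  have "(\<lambda>\<omega>. walk_from x t \<omega> + \<omega> t) \<in> measurable (steps_space p) (count_space UNIV)"
  proof (rule measurable_compose_countable[where g = "walk_from x t"])
    show "(\<lambda>\<omega>. i + \<omega> t) \<in> measurable (steps_space p) (count_space UNIV)" for i
      by (rule measurable_compose[OF measurable_steps_component]) simp
  qed (rule Suc)
  then show ?case by (simp add: walk_from_def add.assoc)
qed

lemma p_walk_walk_from: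
  assumes "0 \<le> p" "p \<le> 1"
  shows "p_walk (steps_space p) p x (walk_from x)"
proof -
  have inj: "inj (\<lambda>b. if b then 1 else - 1 :: int)"
    by (auto simp: inj_def split: if_splits)
  have "pmf (step_pmf p) 1 = p" "pmf (step_pmf p) (-1) = 1 - p"
    unfolding step_pmf_def
    using pmf_map_inj'[OF inj, of "bernoulli_pmf p" True]
      pmf_map_inj'[OF inj, of "bernoulli_pmf p" False] assms by simp_all
  then show ?thesis
    unfolding p_walk_def using measurable_walk_from[of x]
    by (simp add: prob_space_steps_space walk_from_def indep_vars_steps prob_steps)
qed


subsection \<open>The random-walk approximation\<close>

definition stop_A1 :: "(nat \<Rightarrow> 'a \<Rightarrow> int) \<Rightarrow> 'a \<Rightarrow> enat" where
  "stop_A1 A1 = hit_time 0 A1"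

definition stop_A2 :: "(nat \<Rightarrow> 'a \<Rightarrow> int) \<Rightarrow> (nat \<Rightarrow> 'a \<Rightarrow> int) \<Rightarrow> 'a \<Rightarrow> enat" where
  "stop_A2 A1 A2 \<omega> =
     first_time (\<lambda>t. \<exists>m. stop_A1 A1 \<omega> = enat m \<and> int t - A2 t \<omega> = int m + 2)"

text \<open>
  The unstopped walks are independent as processes; only the stopping rule of the second one
  depends on the first one.
\<close>

definition random_walk_approx ::
  "'a measure \<Rightarrow> real \<Rightarrow> nat \<Rightarrow> (nat \<Rightarrow> 'a \<Rightarrow> int) \<Rightarrow> (nat \<Rightarrow> 'a \<Rightarrow> int) \<Rightarrow> bool" where
  "random_walk_approx M \<eta> l A1 A2 \<longleftrightarrow>
     p_walk M \<eta> (int l - 1) A1 \<and>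
     p_walk M (1 - \<eta>) (int l - 1) A2 \<and>
     prob_space.indep_var M
       (\<Pi>\<^sub>M t\<in>UNIV. count_space UNIV) (\<lambda>\<omega> t. A1 t \<omega>)
       (\<Pi>\<^sub>M t\<in>UNIV. count_space UNIV) (\<lambda>\<omega> t. A2 t \<omega>)"

lemma p_walk_compose:
  assumes "prob_space M" and f: "f \<in> measurable M N" and d: "distr M N f = N"
    and X: "p_walk N p x X"
  shows "p_walk M p x (\<lambda>t \<omega>. X t (f \<omega>))"
proof -
  interpret M: prob_space M by fact
  interpret N: prob_space N using X by (simp add: p_walk_def)
  have Xm [measurable]: "X t \<in> measurable N (count_space UNIV)" for t
    using X by (simp add: p_walk_def)
  note f [measurable]
  let ?D = "\<lambda>t \<omega>. X (Suc t) \<omega> - X t \<omega>"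
  have Dm [measurable]: "?D t \<in> measurable N (count_space UNIV)" for t
    using X unfolding p_walk_def N.indep_vars_def2 by blast
  have Dfm [measurable]: "(\<lambda>\<omega>. ?D t (f \<omega>)) \<in> measurable M (count_space UNIV)" for t
    by (rule measurable_compose[OF f Dm])
  have D: "distr M (count_space UNIV) (\<lambda>\<omega>. ?D t (f \<omega>)) = distr N (count_space UNIV) (?D t)" for t
    using distr_distr[OF Dm f] by (simp add: d o_def)
  have P: "\<P>(\<omega> in M. ?D t (f \<omega>) = k) = \<P>(\<omega> in N. ?D t \<omega> = k)" for t k
  proof -
    have "\<P>(\<omega> in M. ?D t (f \<omega>) = k)
          = measure (distr M (count_space UNIV) (\<lambda>\<omega>. ?D t (f \<omega>))) {k}"
      by (subst measure_distr[OF Dfm]) (auto intro!: arg_cong[where f = "measure M"])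
    also have "\<dots> = \<P>(\<omega> in N. ?D t \<omega> = k)"
      unfolding D by (subst measure_distr[OF Dm]) (auto intro!: arg_cong[where f = "measure N"])
    finally show ?thesis .
  qed
  let ?C = "\<Pi>\<^sub>M i\<in>(UNIV::nat set). count_space (UNIV::int set)"
  have Jm: "(\<lambda>\<omega>. \<lambda>t\<in>UNIV. ?D t \<omega>) \<in> measurable N ?C"
    by (rule measurable_restrict) (rule Dm)
  have J: "distr M ?C (\<lambda>\<omega>. \<lambda>t\<in>UNIV. ?D t (f \<omega>)) = distr N ?C (\<lambda>\<omega>. \<lambda>t\<in>UNIV. ?D t \<omega>)"
    using distr_distr[OF Jm f] by (simp add: d o_def)
  have "N.indep_vars (\<lambda>_. count_space UNIV) ?D UNIV"
    using X by (simp add: p_walk_def)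
  then have "M.indep_vars (\<lambda>_. count_space UNIV) (\<lambda>t \<omega>. ?D t (f \<omega>)) UNIV"
    by (subst M.indep_vars_iff_distr_eq_PiM)
       (simp_all add: N.indep_vars_iff_distr_eq_PiM Dm Dfm J D)
  moreover have "(\<lambda>\<omega>. X t (f \<omega>)) \<in> measurable M (count_space UNIV)" for t
    by (rule measurable_compose[OF f Xm])
  moreover have "X 0 (f \<omega>) = x" if "\<omega> \<in> space M" for \<omega>
    using X measurable_space[OF f that] by (simp add: p_walk_def)
  ultimately show ?thesis
    using X unfolding p_walk_def P by (simp add: M.prob_space_axioms)
qed

lemma random_walk_approx_exists:
  assumes "0 \<le> \<eta>" "\<eta> \<le> 1"
  shows "random_walk_approx (steps_space \<eta> \<Otimes>\<^sub>M steps_space (1 - \<eta>)) \<eta> l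
           (\<lambda>t \<omega>. walk_from (int l - 1) t (fst \<omega>)) (\<lambda>t \<omega>. walk_from (int l - 1) t (snd \<omega>))"
proof -
  let ?A = "steps_space \<eta>" and ?B = "steps_space (1 - \<eta>)"
  let ?M = "?A \<Otimes>\<^sub>M ?B"
  let ?C = "\<Pi>\<^sub>M t\<in>(UNIV::nat set). count_space (UNIV::int set)"
  let ?w = "\<lambda>\<omega> t. walk_from (int l - 1) t \<omega>"
  interpret A: prob_space ?A by (rule prob_space_steps_space)
  interpret B: prob_space ?B by (rule prob_space_steps_space)
  interpret P: pair_prob_space ?A ?B ..
  have 1: "distr ?M ?A fst = ?A" by (rule B.distr_pair_fst)
  have 2: "distr ?M ?B snd = ?B"
  proof (rule measure_eqI)
    fix X assume "X \<in> sets (distr ?M ?B snd)"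
    then have X: "X \<in> sets ?B" by simp
    have "emeasure (distr ?M ?B snd) X = emeasure ?M (space ?A \<times> X)"
      using X sets.sets_into_space[OF X]
      by (subst emeasure_distr) (auto simp: space_pair_measure intro!: arg_cong2[where f = emeasure])
    also have "\<dots> = emeasure ?B X"
      using X by (simp add: B.emeasure_pair_measure_Times A.emeasure_space_1)
    finally show "emeasure (distr ?M ?B snd) X = emeasure ?B X" .
  qed simp
  have w: "?w \<in> measurable (steps_space p) ?C" for p
    by (rule measurable_PiM_single') (auto simp: measurable_walk_from)
  have fs: "fst \<in> measurable ?M ?A" "snd \<in> measurable ?M ?B" by simp_all
  have "P.indep_var ?A fst ?B snd"
    unfolding P.indep_var_distribution_eq 1 2 by (auto simp: distr_id2)
  from P.indep_var_compose[OF this w w]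
  have "P.indep_var ?C (\<lambda>\<omega> t. walk_from (int l - 1) t (fst \<omega>))
          ?C (\<lambda>\<omega> t. walk_from (int l - 1) t (snd \<omega>))"
    by (simp add: o_def)
  then show ?thesis
    unfolding random_walk_approx_def
    using assms p_walk_compose[OF P.prob_space_axioms fs(1) 1 p_walk_walk_from]
      p_walk_compose[OF P.prob_space_axioms fs(2) 2 p_walk_walk_from]
    by simp
qed

definition G_II :: "'a measure \<Rightarrow> (nat \<Rightarrow> 'a \<Rightarrow> int) \<Rightarrow> (nat \<Rightarrow> 'a \<Rightarrow> int) \<Rightarrow> complex \<Rightarrow> complex" where
  "G_II M A1 A2 s = prob_gf M (stop_A2 A1 A2) s"

end

theory Submission
  imports Defs
begin

text \<open>
  Given \<open>s\<^bsub>A1\<^esub> = m\<close>, the quantity \<open>t - A\<^bsub>2,t\<^esub>\<close> starts at \<open>1 - \<ell>\<close>, stays put at a step to the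
  right and grows by \<open>2\<close> at a step to the left. The second walk thus ends at its left step number
  \<open>(m + \<ell> + 1) / 2\<close>, an integer by parity whenever \<open>s\<^bsub>A1\<^esub> = m\<close> has positive probability, and its
  end time has generating function \<open>H ^ ((m + \<ell> + 1) / 2) = (csqrt H) ^ (m + \<ell> + 1)\<close>. Averaging over
  \<open>m\<close> evaluates the generating function of the hitting time of \<open>0\<close> from \<open>\<ell> - 1\<close> at \<open>csqrt H\<close>.
  That function is the power \<open>F_minus1 ^ (\<ell> - 1)\<close> because a walk passes every intermediate level.
  All the stopping times are first times at which a state, updated deterministically by the steps of
  a walk, satisfies a predicate; the law of such a time satisfies a one-step recursion.
\<close>

subsection \<open>Stopping times of processes driven by a walk\<close>

text \<open>
  The probability that a state with update function \<open>u\<close>, started in \<open>\<sigma>\<close> and driven by the steps of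
  a \<open>p\<close>-walk, satisfies \<open>P\<close> for the first time at time \<open>k\<close>.
\<close>

primrec stop_prob :: "real \<Rightarrow> ('s \<Rightarrow> bool) \<Rightarrow> ('s \<Rightarrow> int \<Rightarrow> 's) \<Rightarrow> nat \<Rightarrow> 's \<Rightarrow> real" where
  "stop_prob p P u 0 \<sigma> = of_bool (P \<sigma>)"
| "stop_prob p P u (Suc k) \<sigma> =
     (if P \<sigma> then 0
      else p * stop_prob p P u k (u \<sigma> 1) + (1 - p) * stop_prob p P u k (u \<sigma> (-1)))"

definition stop_gf :: "real \<Rightarrow> ('s \<Rightarrow> bool) \<Rightarrow> ('s \<Rightarrow> int \<Rightarrow> 's) \<Rightarrow> 's \<Rightarrow> complex \<Rightarrow> complex" where
  "stop_gf p P u \<sigma> z = (\<Sum>k. of_real (stop_prob p P u k \<sigma>) * z ^ k)"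

lemma stop_prob_nonneg:
  assumes "0 \<le> p" "p \<le> 1"
  shows "0 \<le> stop_prob p P u k \<sigma>"
  using assms by (induction k arbitrary: \<sigma>) auto

text \<open>Optional-stopping bound: \<open>h\<close> is superharmonic off the stopping set and at
  least 1 on it, so conditioning on the first step propagates the bound. The constant 1 bounds the
  total mass; \<open>hit_gf_1_bound\<close> uses a sharper \<open>h\<close>.\<close>

lemma sum_stop_prob_le:
  assumes p: "0 \<le> p" "p \<le> 1"
    and nonneg: "\<And>\<sigma>. 0 \<le> h \<sigma>"
    and stop: "\<And>\<sigma>. P \<sigma> \<Longrightarrow> 1 \<le> h \<sigma>"
    and super: "\<And>\<sigma>. \<not> P \<sigma> \<Longrightarrow> p * h (u \<sigma> 1) + (1 - p) * h (u \<sigma> (-1)) \<le> h \<sigma>"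
  shows "(\<Sum>k<n. stop_prob p P u k \<sigma>) \<le> h \<sigma>"
proof (induction n arbitrary: \<sigma>)
  case 0
  then show ?case by (simp add: nonneg)
next
  case (Suc n)
  show ?case
  proof (cases "P \<sigma>")
    case True
    then show ?thesis
      by (simp add: sum.lessThan_Suc_shift stop del: sum.lessThan_Suc)
  next
    case False
    have "(\<Sum>k<Suc n. stop_prob p P u k \<sigma>)
        = p * (\<Sum>k<n. stop_prob p P u k (u \<sigma> 1)) + (1 - p) * (\<Sum>k<n. stop_prob p P u k (u \<sigma> (-1)))"
      using False
      by (simp add: sum.lessThan_Suc_shift sum.distrib sum_distrib_left del: sum.lessThan_Suc)
    also have "\<dots> \<le> p * h (u \<sigma> 1) + (1 - p) * h (u \<sigma> (-1))"
      using p Suc.IH by (intro add_mono mult_left_mono) auto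
    also have "\<dots> \<le> h \<sigma>"
      by (rule super) fact
    finally show ?thesis .
  qed
qed

lemma summable_stop_prob:
  assumes "0 \<le> p" "p \<le> 1"
  shows "summable (\<lambda>k. stop_prob p P u k \<sigma>)"
  using assms sum_stop_prob_le[of p "\<lambda>_. 1"]
  by (intro summableI_nonneg_bounded[where x = 1]) (auto simp: stop_prob_nonneg)

lemma summable_norm_stop_gf:
  fixes z :: complex
  assumes "0 \<le> p" "p \<le> 1" "norm z \<le> 1"
  shows "summable (\<lambda>k. norm (of_real (stop_prob p P u k \<sigma>) * z ^ k))"
  using assms
  by (intro summable_comparison_test'[OF summable_stop_prob[of p P u \<sigma>]])
     (auto simp: norm_mult norm_power stop_prob_nonneg intro!: mult_left_le power_le_one)

lemma norm_stop_gf_le: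
  assumes p: "0 \<le> p" "p \<le> 1" and z: "norm z \<le> 1"
    and "\<And>\<sigma>. 0 \<le> h \<sigma>"
    and "\<And>\<sigma>. P \<sigma> \<Longrightarrow> 1 \<le> h \<sigma>"
    and "\<And>\<sigma>. \<not> P \<sigma> \<Longrightarrow> p * h (u \<sigma> 1) + (1 - p) * h (u \<sigma> (-1)) \<le> h \<sigma>"
  shows "norm (stop_gf p P u \<sigma> z) \<le> h \<sigma>"
proof -
  have "norm (stop_gf p P u \<sigma> z) \<le> (\<Sum>k. norm (of_real (stop_prob p P u k \<sigma>) * z ^ k))"
    unfolding stop_gf_def by (rule summable_norm[OF summable_norm_stop_gf[OF p z]])
  also have "\<dots> \<le> (\<Sum>k. stop_prob p P u k \<sigma>)"
    using p z
    by (intro suminf_le summable_norm_stop_gf summable_stop_prob)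
       (auto simp: norm_mult norm_power stop_prob_nonneg intro!: mult_left_le power_le_one)
  also have "\<dots> \<le> h \<sigma>"
    using assms
    by (intro suminf_le_const summable_stop_prob sum_stop_prob_le[where h = h]) auto
  finally show ?thesis .
qed

lemma norm_stop_gf_le_1:
  assumes "0 \<le> p" "p \<le> 1" "norm z \<le> 1"
  shows "norm (stop_gf p P u \<sigma> z) \<le> 1"
  by (rule norm_stop_gf_le[where h = "\<lambda>_. 1"]) (use assms in auto)

lemma stop_gf_stopped:
  assumes "P \<sigma>"
  shows "stop_gf p P u \<sigma> z = 1"
proof -
  have "(\<lambda>k. of_real (stop_prob p P u k \<sigma>) * z ^ k) sums
      (\<Sum>k\<in>{0}. of_real (stop_prob p P u k \<sigma>) * z ^ k)"
    using assms by (intro sums_finite) (auto simp: gr0_conv_Suc)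
  then show ?thesis
    using assms by (simp add: stop_gf_def sums_iff)
qed

text \<open>First-step analysis; the factor \<open>z\<close> pays for the unit of time spent. The
  closed forms below solve the resulting quadratic or linear equations.\<close>

lemma stop_gf_step:
  assumes p: "0 \<le> p" "p \<le> 1" and z: "norm z \<le> 1" and "\<not> P \<sigma>"
  shows "stop_gf p P u \<sigma> z
    = z * (of_real p * stop_gf p P u (u \<sigma> 1) z + (1 - of_real p) * stop_gf p P u (u \<sigma> (-1)) z)"
proof -
  note S = summable_norm_cancel[OF summable_norm_stop_gf[OF p z]]
  let ?g = "\<lambda>\<sigma> k. of_real (stop_prob p P u k \<sigma>) * z ^ k"
  have "stop_gf p P u \<sigma> z = (\<Sum>k. ?g \<sigma> (Suc k))"
    using suminf_split_initial_segment[OF S[of P u \<sigma>], of 1] assms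
    by (simp add: stop_gf_def)
  also have "\<dots> = (\<Sum>k. z * (of_real p * ?g (u \<sigma> 1) k + (1 - of_real p) * ?g (u \<sigma> (-1)) k))"
    using assms by (simp add: algebra_simps)
  also have "\<dots> = z * (of_real p * stop_gf p P u (u \<sigma> 1) z
      + (1 - of_real p) * stop_gf p P u (u \<sigma> (-1)) z)"
    unfolding stop_gf_def
    by (simp add: suminf_mult suminf_add[symmetric] summable_add summable_mult S)
  finally show ?thesis .
qed

text \<open>The state never moves. This covers \<open>p = z = 1\<close>, where the first-step
  equation becomes a tautology and determines nothing.\<close>

lemma stop_gf_1_fixed:
  assumes "\<not> P \<sigma>" "u \<sigma> 1 = \<sigma>"
  shows "stop_gf 1 P u \<sigma> z = 0"
proof -
  have "stop_prob 1 P u k \<sigma> = 0" for k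
    using assms by (induction k) auto
  then show ?thesis
    by (simp add: stop_gf_def)
qed

subsection \<open>Hitting times of zero\<close>

abbreviation hit_prob :: "real \<Rightarrow> nat \<Rightarrow> int \<Rightarrow> real" where
  "hit_prob p \<equiv> stop_prob p (\<lambda>x. x = 0) (+)"

abbreviation hit_gf :: "real \<Rightarrow> int \<Rightarrow> complex \<Rightarrow> complex" where
  "hit_gf p \<equiv> stop_gf p (\<lambda>x. x = 0) (+)"

text \<open>Each step flips the parity of the position. This removes the terms whose number of left
  steps would be a half-integer.\<close>

lemma hit_prob_odd: "odd (x + int k) \<Longrightarrow> hit_prob p k x = 0"
  by (induction k arbitrary: x) auto

text \<open>A nearest-neighbour walk from \<open>x + y\<close> must visit \<open>y\<close> before
  \<open>0\<close>; \<open>i\<close> is the time of the first such visit.\<close>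

lemma hit_prob_add:
  assumes "0 \<le> x" "0 \<le> y"
  shows "hit_prob p k (x + y) = (\<Sum>i\<le>k. hit_prob p i x * hit_prob p (k - i) y)"
  using assms
proof (induction k arbitrary: x)
  case 0
  then show ?case by auto
next
  case (Suc k)
  show ?case
  proof (cases "x = 0")
    case True
    \<comment> \<open>Only \<open>i = 0\<close> contributes, as a walk started in \<open>0\<close>
      stops at once.\<close>
    have "(\<Sum>i\<le>Suc k. hit_prob p i x * hit_prob p (Suc k - i) y) = hit_prob p (Suc k) y"
      using True by (subst sum.atMost_Suc_shift) simp
    then show ?thesis using True by simp
  next
    case False
    then have "hit_prob p (Suc k) (x + y)
        = p * hit_prob p k ((x + 1) + y) + (1 - p) * hit_prob p k ((x - 1) + y)"
      using Suc.prems by (simp add: algebra_simps)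
    also have "\<dots> = (\<Sum>i\<le>k. hit_prob p (Suc i) x * hit_prob p (k - i) y)"
      using False Suc.prems
      by (subst (1 2) Suc.IH) (simp_all add: sum_distrib_left sum.distrib sum_subtractf algebra_simps)
    also have "\<dots> = (\<Sum>i\<le>Suc k. hit_prob p i x * hit_prob p (Suc k - i) y)"
      using False by (subst sum.atMost_Suc_shift) simp
    finally show ?thesis .
  qed
qed

lemma hit_gf_add:
  assumes p: "0 \<le> p" "p \<le> 1" and z: "norm z \<le> 1" and "0 \<le> x" "0 \<le> y"
  shows "hit_gf p (x + y) z = hit_gf p x z * hit_gf p y z"
proof -
  have "hit_gf p x z * hit_gf p y z
      = (\<Sum>k. \<Sum>i\<le>k. (of_real (hit_prob p i x) * z ^ i)
          * (of_real (hit_prob p (k - i) y) * z ^ (k - i)))"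
    unfolding stop_gf_def by (intro Cauchy_product summable_norm_stop_gf p z)
  also have "\<dots> = (\<Sum>k. of_real (hit_prob p k (x + y)) * z ^ k)"
  proof (intro suminf_cong)
    fix k
    have "(of_real (hit_prob p i x) * z ^ i) * (of_real (hit_prob p (k - i) y) * z ^ (k - i))
        = of_real (hit_prob p i x * hit_prob p (k - i) y) * z ^ k" if "i \<le> k" for i
      using power_add[of z i "k - i"] that by simp
    then show "(\<Sum>i\<le>k. (of_real (hit_prob p i x) * z ^ i) * (of_real (hit_prob p (k - i) y) * z ^ (k - i)))
        = of_real (hit_prob p k (x + y)) * z ^ k"
      unfolding hit_prob_add[OF assms(4,5)] of_real_sum sum_distrib_right
      by (intro sum.cong refl) simp
  qed
  finally show ?thesis
    by (simp add: stop_gf_def)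
qed

lemma hit_gf_power:
  assumes "0 \<le> p" "p \<le> 1" "norm z \<le> 1"
  shows "hit_gf p (int n) z = hit_gf p 1 z ^ n"
proof (induction n)
  case 0
  then show ?case by (simp add: stop_gf_stopped)
next
  case (Suc n)
  then show ?case using hit_gf_add[OF assms, of 1 "int n"] by simp
qed

text \<open>
  This bound selects the branch of the square root in \<open>hit_gf_1_eq\<close>. For \<open>p > 1 / 2\<close> it needs the
  superharmonic function \<open>((1 - p) / p) ^ x\<close>, since the trivial bound \<open>1\<close> on the generating function
  is too weak there.
\<close>

lemma hit_gf_1_bound:
  assumes p: "0 \<le> p" "p \<le> 1" and z: "norm z \<le> 1"
  shows "norm (2 * of_real p * z * hit_gf p 1 z) \<le> 1"
proof -
  have "p * norm (hit_gf p 1 z) \<le> 1 / 2"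
  proof (cases "p \<le> 1 / 2")
    case True
    then show ?thesis
      using mult_mono[OF True norm_stop_gf_le_1[OF p z]] by simp
  next
    case False
    \<comment> \<open>The root other than 1 of \<open>p * c\<^sup>2 - c + (1 - p) = 0\<close>, which
      makes \<open>c ^ x\<close> harmonic; \<open>p * c = 1 - p\<close> is below
      \<open>1 / 2\<close> here.\<close>
    define c where "c = (1 - p) / p"
    have c: "0 \<le> c" "p * c = 1 - p"
      using p False by (auto simp: c_def)
    have "norm (hit_gf p 1 z) \<le> c ^ nat 1"
    proof (rule norm_stop_gf_le[OF p z])
      fix x :: int assume x: "x \<noteq> 0"
      show "p * c ^ nat (x + 1) + (1 - p) * c ^ nat (x + -1) \<le> c ^ nat x"
      proof (cases "x < 0")
        \<comment> \<open>\<open>nat\<close> truncates all three exponents to 0, so \<open>h\<close>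
          is constantly 1 on the negative half-line.\<close>
        case True
        then show ?thesis by simp
      next
        case False
        define n where "n = nat (x - 1)"
        have n: "nat (x + 1) = Suc (Suc n)" "nat (x + -1) = n" "nat x = Suc n"
          using x False by (auto simp: n_def)
        have "p * c ^ nat (x + 1) + (1 - p) * c ^ nat (x + -1)
            = ((p * c) * c + (1 - p)) * c ^ n"
          unfolding n by (simp add: algebra_simps)
        also have "(p * c) * c + (1 - p) = c"
          using c p by algebra
        finally show ?thesis by (simp add: n)
      qed
    qed (use c in auto)
    then have "p * norm (hit_gf p 1 z) \<le> p * c"
      using p by (intro mult_left_mono) auto
    then show ?thesis using False by (simp add: c)
  qed
  moreover have "norm z * (p * norm (hit_gf p 1 z)) \<le> 1 * (p * norm (hit_gf p 1 z))"
    using p z by (intro mult_right_mono) auto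
  ultimately show ?thesis
    using p by (simp add: norm_mult algebra_simps)
qed

text \<open>The first-step equation is quadratic, since reaching \<open>0\<close> from
  \<open>2\<close> has generating function \<open>f\<^sup>2\<close>. Completing the square turns the
  radicand into \<open>(1 - w)\<^sup>2\<close>.\<close>

lemma hit_gf_1_eq:
  assumes p: "0 \<le> p" "p \<le> 1" and z: "norm z \<le> 1"
  shows "hit_gf p 1 z =
    (if of_real p * z = 0 then z
     else (1 - csqrt (1 - 4 * of_real p * (1 - of_real p) * z\<^sup>2)) / (2 * of_real p * z))"
proof -
  define f where "f = hit_gf p 1 z"
  define w where "w = 2 * of_real p * z * f"
  have f: "f = z * (of_real p * f\<^sup>2 + (1 - of_real p))"
    using stop_gf_step[OF p z, of "\<lambda>x. x = 0" 1 "(+)"] hit_gf_power[OF p z, of 2]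
    by (simp add: f_def stop_gf_stopped)
  have w1: "norm w \<le> 1"
    using hit_gf_1_bound[OF p z] by (simp add: w_def f_def)
  have sq: "1 - 4 * of_real p * (1 - of_real p) * z\<^sup>2 = (1 - w)\<^sup>2"
    using f unfolding w_def by algebra
  \<comment> \<open>As \<open>w\<close> lies in the closed unit disc, \<open>1 - w\<close> has
    nonnegative real part and is 0 when that part vanishes; hence it is the principal root.\<close>
  have "csqrt ((1 - w)\<^sup>2) = 1 - w"
  proof (rule csqrt_unique)
    have "Re w \<le> 1" using complex_Re_le_cmod[of w] w1 by linarith
    moreover have "Im w = 0" if "Re w = 1"
    proof -
      have "(Re w)\<^sup>2 + (Im w)\<^sup>2 \<le> 1"
        using w1 by (simp add: cmod_def)
      then show ?thesis using that by simp
    qed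
    ultimately show "0 < Re (1 - w) \<or> Re (1 - w) = 0 \<and> 0 \<le> Im (1 - w)"
      by auto
  qed simp
  then have "1 - csqrt (1 - 4 * of_real p * (1 - of_real p) * z\<^sup>2) = w"
    by (simp add: sq)
  \<comment> \<open>Here the quadratic term and the term \<open>p * z\<close> drop out of the
    equation for \<open>f\<close>.\<close>
  moreover have "f = z" if "of_real p * z = 0"
    using f that by auto
  ultimately show ?thesis
    by (auto simp: w_def f_def)
qed

subsection \<open>Steps to the left\<close>

text \<open>The Boolean state records whether the latest step went left; starting in
  \<open>False\<close> excludes time 0.\<close>

abbreviation left_gf :: "real \<Rightarrow> complex \<Rightarrow> complex" where
  "left_gf p \<equiv> stop_gf p (\<lambda>b. b) (\<lambda>_ d. d = -1) False"

text \<open>Two factors \<open>p\<close> and \<open>norm z\<close> of size at most 1 have product 1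
  only if both are 1. This isolates the single zero of the denominator
  \<open>1 - p * z\<close>.\<close>

lemma of_real_mult_eq_1:
  fixes z :: complex
  assumes "0 \<le> p" "p \<le> 1" "norm z \<le> 1" "of_real p * z = 1"
  shows "p = 1" "z = 1"
proof -
  have "p * norm z = 1"
    using arg_cong[OF assms(4), of norm] assms(1) by (simp add: norm_mult)
  moreover have "p * norm z \<le> p * 1"
    using assms by (intro mult_left_mono) auto
  ultimately show "p = 1" using assms by simp
  then show "z = 1" using assms by simp
qed

text \<open>A right step leaves the state \<open>False\<close>, so the first-step equation is
  linear. At \<open>p = z = 1\<close> both sides are 0, the right one by division by zero.\<close>

lemma left_gf_eq:
  assumes p: "0 \<le> p" "p \<le> 1" and z: "norm z \<le> 1"
  shows "left_gf p z = ((1 - of_real p) * z) / (1 - of_real p * z)"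
proof (cases "of_real p * z = 1")
  case True
  then show ?thesis
    using of_real_mult_eq_1[OF p z True] by (simp add: stop_gf_1_fixed)
next
  case False
  have "left_gf p z = z * (of_real p * left_gf p z + (1 - of_real p))"
    using stop_gf_step[OF p z, of "\<lambda>b. b" False "\<lambda>_ d. d = -1"] by (simp add: stop_gf_stopped)
  then show ?thesis
    using False by (simp add: field_simps)
qed

text \<open>
  The state is the distance of \<open>t - A\<^bsub>2,t\<^esub>\<close> from its target; it drops by \<open>2\<close> at each step to the left.
\<close>

abbreviation count_gf :: "real \<Rightarrow> int \<Rightarrow> complex \<Rightarrow> complex" where
  "count_gf p \<equiv> stop_gf p (\<lambda>c. c = 0) (\<lambda>c d. c - 1 + d)"

text \<open>Right steps leave the distance unchanged, so \<open>n\<close> left steps are awaited in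
  succession and each wait contributes one factor.\<close>

lemma count_gf_eq:
  assumes p: "0 \<le> p" "p \<le> 1" and z: "norm z \<le> 1"
  shows "count_gf p (2 * int n) z = left_gf p z ^ n"
proof (induction n)
  case 0
  then show ?case by (simp add: stop_gf_stopped)
next
  case (Suc n)
  have c: "2 * int (Suc n) - 1 + - 1 = 2 * int n" by simp
  show ?case
  proof (cases "of_real p * z = 1")
    case True
    then show ?thesis
      using of_real_mult_eq_1[OF p z True] by (simp add: stop_gf_1_fixed)
  next
    case False
    have "count_gf p (2 * int (Suc n)) z
        = z * (of_real p * count_gf p (2 * int (Suc n)) z + (1 - of_real p) * count_gf p (2 * int n) z)"
      using stop_gf_step[OF p z, of "\<lambda>c. c = 0" "2 * int (Suc n)" "\<lambda>c d. c - 1 + d"]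
      unfolding c by simp
    then have "count_gf p (2 * int (Suc n)) z * (1 - of_real p * z)
        = (1 - of_real p) * z * count_gf p (2 * int n) z"
      by algebra
    then have "count_gf p (2 * int (Suc n)) z = left_gf p z * count_gf p (2 * int n) z"
      unfolding left_gf_eq[OF p z] using False by (simp add: nonzero_eq_divide_eq)
    then show ?thesis
      by (simp add: Suc.IH)
  qed
qed

subsection \<open>Reduction of walks on arbitrary probability spaces\<close>

lemma first_time_eq_enat_iff:
  "first_time P = enat k \<longleftrightarrow> P k \<and> (\<forall>i<k. \<not> P i)"
proof
  assume k: "first_time P = enat k"
  then have "enat ` {t. P t} \<noteq> {}"
    by (auto simp: first_time_def Inf_enat_def simp del: Collect_empty_eq)
  then have "first_time P \<in> enat ` {t. P t}"
    unfolding first_time_def Inf_enat_def by (auto intro: LeastI)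
  moreover have "k \<le> i" if "P i" for i
    using Inf_lower[of "enat i" "enat ` {t. P t}"] that k by (simp add: first_time_def)
  ultimately show "P k \<and> (\<forall>i<k. \<not> P i)"
    using k by (auto simp: not_le[symmetric])
next
  assume "P k \<and> (\<forall>i<k. \<not> P i)"
  then show "first_time P = enat k"
    unfolding first_time_def
    by (intro antisym Inf_lower Inf_greatest) (auto simp: not_less[symmetric])
qed

text \<open>Encodes stopping exactly after the whole word: no proper prefix may lead to a stopped
  state.\<close>

primrec stops_with :: "('s \<Rightarrow> bool) \<Rightarrow> ('s \<Rightarrow> int \<Rightarrow> 's) \<Rightarrow> 's \<Rightarrow> int list \<Rightarrow> bool" where
  "stops_with P u \<sigma> [] \<longleftrightarrow> P \<sigma>"
| "stops_with P u \<sigma> (d # ds) \<longleftrightarrow> \<not> P \<sigma> \<and> stops_with P u (u \<sigma> d) ds"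

lemma stops_with_iff_first_time:
  assumes "s 0 = \<sigma>" "\<And>t. s (Suc t) = u (s t) (D t)"
  shows "stops_with P u \<sigma> (map D [0..<k]) \<longleftrightarrow> first_time (\<lambda>t. P (s t)) = enat k"
  using assms
proof (induction k arbitrary: s D \<sigma>)
  case 0
  then show ?case by (simp add: first_time_eq_enat_iff)
next
  case (Suc k)
  \<comment> \<open>Splits off the first step; the induction hypothesis is applied to the trajectory
    shifted by one.\<close>
  have "map D [0..<Suc k] = D 0 # map (\<lambda>i. D (Suc i)) [0..<k]"
    by (simp add: map_upt_Suc del: upt_Suc)
  moreover have "stops_with P u (u \<sigma> (D 0)) (map (\<lambda>i. D (Suc i)) [0..<k])
      \<longleftrightarrow> first_time (\<lambda>t. P (s (Suc t))) = enat k"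
    using Suc.prems by (intro Suc.IH) auto
  ultimately show ?case
    using Suc.prems by (auto simp: first_time_eq_enat_iff All_less_Suc2)
qed

text \<open>Drawing the first step separately reproduces the recursion of
  \<open>stop_prob\<close>.\<close>

lemma prob_stops_with:
  assumes "0 \<le> p" "p \<le> 1"
  shows "measure_pmf.prob (replicate_pmf k (step_pmf p)) {ds. stops_with P u \<sigma> ds} = stop_prob p P u k \<sigma>"
proof -
  have "pmf (map_pmf (stops_with P u \<sigma>) (replicate_pmf k (step_pmf p))) True = stop_prob p P u k \<sigma>"
  proof (induction k arbitrary: \<sigma>)
    case 0
    then show ?case by (simp add: map_return_pmf indicator_def)
  next
    case (Suc k)
    have "map_pmf (stops_with P u \<sigma>) (replicate_pmf (Suc k) (step_pmf p)) =
      bernoulli_pmf p \<bind> (\<lambda>b. map_pmf (\<lambda>ds. \<not> P \<sigma> \<and> stops_with P u (u \<sigma> (if b then 1 else -1)) ds)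
         (replicate_pmf k (step_pmf p)))"
      by (simp add: step_pmf_def bind_map_pmf map_bind_pmf map_pmf_def bind_assoc_pmf bind_return_pmf)
    then show ?case
      using assms Suc.IH by (cases "P \<sigma>") (simp_all add: pmf_bind map_pmf_const)
  qed
  then show ?thesis
    by (simp add: pmf_map vimage_def)
qed

section \<open>The law of the first steps of an arbitrary walk\<close>

lemma pmf_replicate_pmf:
  "pmf (replicate_pmf k q) ds = (if length ds = k then \<Prod>i<k. pmf q (ds ! i) else 0)"
proof (induction k arbitrary: ds)
  case 0
  then show ?case by (simp add: indicator_def)
next
  case (Suc k)
  have eq: "replicate_pmf (Suc k) q = map_pmf (\<lambda>(x, xs). x # xs) (pair_pmf q (replicate_pmf k q))"
    by (simp add: pair_pmf_def map_bind_pmf map_pmf_def bind_assoc_pmf bind_return_pmf)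
  show ?case
  proof (cases ds)
    case Nil
    then show ?thesis
      unfolding eq by (auto simp: pmf_eq_0_set_pmf)
  next
    case (Cons d ds')
    have "pmf (replicate_pmf (Suc k) q) ((\<lambda>(x, xs). x # xs) (d, ds')) = pmf q d * pmf (replicate_pmf k q) ds'"
      unfolding eq by (subst pmf_map_inj') (auto simp: inj_def pmf_pair)
    then show ?thesis
      using Cons Suc.IH by (simp add: prod.lessThan_Suc_shift del: prod.lessThan_Suc replicate_pmf.simps)
  qed
qed

lemma p_walk_bounds:
  assumes "p_walk M p x X"
  shows "0 \<le> p" "p \<le> 1"
proof -
  have "p = \<P>(\<omega> in M. X 1 \<omega> - X 0 \<omega> = 1)" "1 - p = \<P>(\<omega> in M. X 1 \<omega> - X 0 \<omega> = -1)"
    using assms unfolding p_walk_def by (metis One_nat_def)+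
  then show "0 \<le> p" "p \<le> 1"
    by (metis measure_nonneg, metis measure_nonneg diff_ge_0_iff_ge)
qed

text \<open>The values \<open>1\<close> and \<open>-1\<close> already carry the mass
  \<open>p + (1 - p) = 1\<close>, so any other value is null.\<close>

lemma p_walk_step_prob:
  assumes X: "p_walk M p x X"
  shows "\<P>(\<omega> in M. X (Suc t) \<omega> - X t \<omega> = d) = pmf (step_pmf p) d"
proof -
  interpret prob_space M using X by (simp add: p_walk_def)
  let ?D = "\<lambda>\<omega>. X (Suc t) \<omega> - X t \<omega>"
  have D [measurable]: "?D \<in> measurable M (count_space UNIV)"
    using X unfolding p_walk_def indep_vars_def2 by blast
  have *: "pmf (step_pmf p) 1 = p" "pmf (step_pmf p) (-1) = 1 - p"
    using p_walk_walk_from[OF p_walk_bounds[OF X], of 0]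
    by (simp_all add: p_walk_def walk_from_def prob_steps)
  show ?thesis
  proof (cases "d = 1 \<or> d = -1")
    case True
    then show ?thesis using X * by (auto simp: p_walk_def)
  next
    case False
    have "prob {\<omega>\<in>space M. ?D \<omega> = 1} + prob {\<omega>\<in>space M. ?D \<omega> = -1} + prob {\<omega>\<in>space M. ?D \<omega> = d}
        = prob ({\<omega>\<in>space M. ?D \<omega> = 1} \<union> {\<omega>\<in>space M. ?D \<omega> = -1} \<union> {\<omega>\<in>space M. ?D \<omega> = d})"
      using False by (subst finite_measure_Union, measurable, force, subst finite_measure_Union) auto
    also have "\<dots> \<le> 1" by (rule prob_le_1)
    finally have "\<P>(\<omega> in M. ?D \<omega> = d) \<le> 0"
      using X by (simp add: p_walk_def)
    then have "\<P>(\<omega> in M. ?D \<omega> = d) = 0"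
      by (simp add: measure_le_0_iff)
    moreover have "pmf (step_pmf p) d = 0"
      using False by (auto simp: step_pmf_def pmf_eq_0_set_pmf)
    ultimately show ?thesis by simp
  qed
qed

text \<open>Independence gives each step word its product probability; words form a countable type,
  so point masses determine the law.\<close>

lemma distr_p_walk_steps:
  assumes X: "p_walk M p x X"
  defines "L k \<omega> \<equiv> map (\<lambda>i. X (Suc i) \<omega> - X i \<omega>) [0..<k]"
  shows "L k \<in> measurable M (count_space UNIV)"
    and "distr M (count_space UNIV) (L k) = measure_pmf (replicate_pmf k (step_pmf p))"
proof -
  interpret prob_space M using X by (simp add: p_walk_def)
  let ?D = "\<lambda>i \<omega>. X (Suc i) \<omega> - X i \<omega>"
  have D [measurable]: "?D i \<in> measurable M (count_space UNIV)" for i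
    using X unfolding p_walk_def indep_vars_def2 by blast
  have L_eq: "L j \<omega> = ds \<longleftrightarrow> length ds = j \<and> (\<forall>i<j. ?D i \<omega> = ds ! i)" for j \<omega> ds
    by (auto simp: L_def list_eq_iff_nth_eq)
  show L [measurable]: "L k \<in> measurable M (count_space UNIV)"
    by (subst measurable_count_space_eq2_countable) (auto simp: vimage_def Int_def conj_commute L_eq)
  show "distr M (count_space UNIV) (L k) = measure_pmf (replicate_pmf k (step_pmf p))"
  proof (rule measure_eqI_countable[where A = UNIV])
    fix ds :: "int list"
    have "prob (L k -` {ds} \<inter> space M) = pmf (replicate_pmf k (step_pmf p)) ds"
    proof (cases "length ds = k")
      case len: True
      show ?thesis
      \<comment> \<open>For \<open>k = 0\<close> the intersection used below would be empty-indexed,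
        hence \<open>UNIV\<close> instead of \<open>space M\<close>.\<close>
      proof (cases "k = 0")
        case True
        then have "L k -` {ds} \<inter> space M = space M"
          using len by (auto simp: L_def)
        then show ?thesis using True len by (simp add: prob_space)
      next
        case False
        have "L k -` {ds} \<inter> space M = (\<Inter>i\<in>{..<k}. ?D i -` {ds ! i} \<inter> space M)"
          using len False by (auto simp: L_eq)
        also have "prob \<dots> = (\<Prod>i<k. prob (?D i -` {ds ! i} \<inter> space M))"
          using X False by (intro indep_varsD[where I = UNIV]) (auto simp: p_walk_def)
        also have "\<dots> = (\<Prod>i<k. pmf (step_pmf p) (ds ! i))"
          using p_walk_step_prob[OF X] by (simp add: vimage_def Int_def conj_commute)
        finally show ?thesis
          using len by (simp add: pmf_replicate_pmf)
      qed
    next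
      case False
      then have "L k -` {ds} \<inter> space M = {}"
        using L_eq by blast
      then show ?thesis using False by (simp add: pmf_replicate_pmf)
    qed
    then show "emeasure (distr M (count_space UNIV) (L k)) {ds}
        = emeasure (measure_pmf (replicate_pmf k (step_pmf p))) {ds}"
      by (simp add: emeasure_distr emeasure_eq_measure emeasure_pmf_single)
  qed auto
qed

text \<open>The event depends only on the first \<open>k\<close> steps, whose law is the same on
  every probability space.\<close>

lemma p_walk_first_time:
  assumes X: "p_walk M p x X"
    and S: "\<And>\<omega>. \<omega> \<in> space M \<Longrightarrow> S 0 \<omega> = \<sigma>"
      "\<And>t \<omega>. S (Suc t) \<omega> = u (S t \<omega>) (X (Suc t) \<omega> - X t \<omega>)"
  shows "\<P>(\<omega> in M. first_time (\<lambda>t. P (S t \<omega>)) = enat k) = stop_prob p P u k \<sigma>"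
proof -
  let ?L = "\<lambda>\<omega>. map (\<lambda>i. X (Suc i) \<omega> - X i \<omega>) [0..<k]"
  have "{\<omega>\<in>space M. first_time (\<lambda>t. P (S t \<omega>)) = enat k}
      = ?L -` {ds. stops_with P u \<sigma> ds} \<inter> space M"
    using stops_with_iff_first_time[of "\<lambda>t. S t \<omega>" \<sigma> u "\<lambda>i. X (Suc i) \<omega> - X i \<omega>" P k for \<omega>] S
    by auto
  also have "measure M \<dots> = measure (distr M (count_space UNIV) ?L) {ds. stops_with P u \<sigma> ds}"
    by (rule measure_distr[symmetric]) (auto intro: distr_p_walk_steps[OF X])
  also have "\<dots> = stop_prob p P u k \<sigma>"
    by (simp add: distr_p_walk_steps[OF X] prob_stops_with p_walk_bounds[OF X])
  finally show ?thesis .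
qed

section \<open>Identification of the concrete stopping times\<close>

lemma p_walk_hit_time:
  assumes X: "p_walk M p x X"
  shows "\<P>(\<omega> in M. hit_time 0 X \<omega> = enat k) = hit_prob p k x"
  unfolding hit_time_def
  by (rule p_walk_first_time[OF X]) (use X in \<open>auto simp: p_walk_def\<close>)

lemma F_minus1_eq:
  assumes "0 \<le> p" "p \<le> 1"
  shows "F_minus1 p z = hit_gf p 1 z"
  unfolding F_minus1_def prob_gf_def stop_gf_def
  by (simp add: p_walk_hit_time[OF p_walk_walk_from[OF assms]])

lemma H_left_eq:
  assumes "0 \<le> p" "p \<le> 1"
  shows "H_left p z = left_gf p z"
proof -
  let ?W = "walk_from 0"
  have "\<P>(\<omega> in steps_space p. first_left_time ?W \<omega> = enat k)
      = stop_prob p (\<lambda>b. b) (\<lambda>_ d. d = -1) k False" for k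
    unfolding first_left_time_def
    \<comment> \<open>The state is \<open>False\<close> at time 0 because of \<open>0 < t\<close>,
      and later depends on the latest step alone.\<close>
    by (rule p_walk_first_time[OF p_walk_walk_from[OF assms, of 0], where S = "\<lambda>t \<omega>. 0 < t \<and> ?W t \<omega> = ?W (t - 1) \<omega> - 1"
         and P = "\<lambda>b. b"])
       (auto simp: algebra_simps)
  then show ?thesis
    by (simp add: H_left_def prob_gf_def stop_gf_def)
qed

subsection \<open>The approximated classification time\<close>

text \<open>Total probability over the finite values \<open>m\<close> of \<open>stop_A1\<close>. For
  fixed \<open>m\<close> the target of the second walk is deterministic, so independence of the
  trajectories factors each term.\<close>

lemma prob_stop_A2:
  assumes "random_walk_approx M \<eta> l A1 A2"
  shows "(\<lambda>m. hit_prob \<eta> m (int l - 1)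
            * stop_prob (1 - \<eta>) (\<lambda>c. c = 0) (\<lambda>c d. c - 1 + d) k (int m + int l + 1))
          sums \<P>(\<omega> in M. stop_A2 A1 A2 \<omega> = enat k)"
proof -
  have A1: "p_walk M \<eta> (int l - 1) A1" and A2: "p_walk M (1 - \<eta>) (int l - 1) A2"
    using assms by (simp_all add: random_walk_approx_def)
  interpret prob_space M using A1 by (simp add: p_walk_def)
  let ?C = "\<Pi>\<^sub>M t\<in>(UNIV::nat set). count_space (UNIV::int set)"
  let ?T = "\<lambda>m w. first_time (\<lambda>t. int t - w t = int m + 2)"
  have ind: "indep_var ?C (\<lambda>\<omega> t. A1 t \<omega>) ?C (\<lambda>\<omega> t. A2 t \<omega>)"
    using assms by (simp add: random_walk_approx_def)
  have meas: "{w\<in>space ?C. first_time (\<lambda>t. Q t (w t)) = enat j} \<in> sets ?C" for Q j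
  proof -
    have "{w\<in>space ?C. Q t (w t)} \<in> sets ?C" for t
      by (rule measurable_sets_Collect[OF measurable_component_singleton]) auto
    then show ?thesis
      unfolding first_time_eq_enat_iff
      by (intro sets.sets_Collect_conj sets.sets_Collect_countable_All sets.sets_Collect_imp
          sets.sets_Collect_neg sets.sets_Collect_const)
  qed
  define E1 where "E1 m = {w\<in>space ?C. first_time (\<lambda>t. w t = 0) = enat m}" for m
  define E2 where "E2 m = {w\<in>space ?C. ?T m w = enat k}" for m
  have E: "E1 m \<in> sets ?C" "E2 m \<in> sets ?C" for m
    unfolding E1_def E2_def by (rule meas)+
  define B where "B m = {\<omega>\<in>space M. hit_time 0 A1 \<omega> = enat m \<and> ?T m (\<lambda>t. A2 t \<omega>) = enat k}" for m
  have B_eq: "B m = (\<lambda>\<omega>. (\<lambda>t. A1 t \<omega>, \<lambda>t. A2 t \<omega>)) -` (E1 m \<times> E2 m) \<inter> space M" for m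
    by (auto simp: B_def E1_def E2_def hit_time_def space_PiM)
  have B_sets: "B m \<in> sets M" for m
  proof -
    have "B m = ((\<lambda>\<omega> t. A1 t \<omega>) -` E1 m \<inter> space M) \<inter> ((\<lambda>\<omega> t. A2 t \<omega>) -` E2 m \<inter> space M)"
      unfolding B_eq by auto
    then show ?thesis
      using measurable_sets[OF indep_var_rv1[OF ind] E(1)[of m]]
        measurable_sets[OF indep_var_rv2[OF ind] E(2)[of m]] by auto
  qed
  have B_prob: "prob (B m) = hit_prob \<eta> m (int l - 1)
      * stop_prob (1 - \<eta>) (\<lambda>c. c = 0) (\<lambda>c d. c - 1 + d) k (int m + int l + 1)" for m
  proof -
    have "prob (B m) = prob ((\<lambda>\<omega> t. A1 t \<omega>) -` E1 m \<inter> space M) * prob ((\<lambda>\<omega> t. A2 t \<omega>) -` E2 m \<inter> space M)"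
      unfolding B_eq by (rule indep_varD[OF ind E])
    also have "(\<lambda>\<omega> t. A1 t \<omega>) -` E1 m \<inter> space M = {\<omega>\<in>space M. hit_time 0 A1 \<omega> = enat m}"
      by (auto simp: E1_def hit_time_def space_PiM)
    also have "prob \<dots> = hit_prob \<eta> m (int l - 1)"
      by (rule p_walk_hit_time[OF A1])
    also have "(\<lambda>\<omega> t. A2 t \<omega>) -` E2 m \<inter> space M
        = {\<omega>\<in>space M. first_time (\<lambda>t. int m + 2 - int t + A2 t \<omega> = 0) = enat k}"
      by (auto simp: E2_def space_PiM first_time_eq_enat_iff algebra_simps)
    also have "prob \<dots> = stop_prob (1 - \<eta>) (\<lambda>c. c = 0) (\<lambda>c d. c - 1 + d) k (int m + int l + 1)"
      \<comment> \<open>The remaining distance starts at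
        \<open>m + 2 + (l - 1) = m + l + 1\<close>.\<close>
      by (rule p_walk_first_time[OF A2, where S = "\<lambda>t \<omega>. int m + 2 - int t + A2 t \<omega>"])
         (use A2 in \<open>auto simp: p_walk_def\<close>)
    finally show ?thesis .
  qed
  have "(\<lambda>m. prob (B m)) sums prob (\<Union>m. B m)"
    using B_sets by (intro finite_measure_UNION) (auto simp: disjoint_family_on_def B_def)
  \<comment> \<open>If \<open>stop_A1\<close> is infinite then so is \<open>stop_A2\<close>; hence
    such outcomes lie in neither set.\<close>
  also have "(\<Union>m. B m) = {\<omega>\<in>space M. stop_A2 A1 A2 \<omega> = enat k}"
    by (auto simp: B_def stop_A2_def stop_A1_def first_time_eq_enat_iff)
  finally show ?thesis
    by (simp add: B_prob)
qed

text \<open>Both iterated series agree with iterated unordered sums, to which Fubini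
  applies.\<close>

lemma suminf_swap:
  fixes f :: "nat \<Rightarrow> nat \<Rightarrow> complex"
  assumes f: "(\<lambda>(m, k). f m k) summable_on UNIV \<times> UNIV"
  shows "(\<Sum>m. \<Sum>k. f m k) = (\<Sum>k. \<Sum>m. f m k)"
proof -
  have *: "(\<Sum>m. \<Sum>k. g m k) = (\<Sum>\<^sub>\<infinity>m. \<Sum>\<^sub>\<infinity>k. g m k)"
    if g: "(\<lambda>(m, k). g m k) summable_on UNIV \<times> UNIV" for g :: "nat \<Rightarrow> nat \<Rightarrow> complex"
  proof -
    have "(\<Sum>k. g m k) = (\<Sum>\<^sub>\<infinity>k. g m k)" for m
      using summable_on_SigmaD1[OF g UNIV_I, of m]
      by (auto dest!: has_sum_infsum has_sum_imp_sums simp: sums_iff)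
    moreover have "(\<Sum>m. \<Sum>\<^sub>\<infinity>k. g m k) = (\<Sum>\<^sub>\<infinity>m. \<Sum>\<^sub>\<infinity>k. g m k)"
      using summable_on_Sigma_banach[OF g]
      by (auto dest!: has_sum_infsum has_sum_imp_sums simp: sums_iff)
    ultimately show ?thesis by simp
  qed
  have f': "(\<lambda>(k, m). f m k) summable_on UNIV \<times> UNIV"
    using f by (subst summable_on_swap) simp
  show ?thesis
    unfolding *[OF f] *[OF f'] by (rule infsum_swap_banach[OF f])
qed

lemma G_II_eq:
  assumes "1 \<le> l" and rw: "random_walk_approx M \<eta> l A1 A2" and s: "norm s \<le> 1"
  shows "G_II M A1 A2 s = hit_gf \<eta> 1 (csqrt (left_gf (1 - \<eta>) s)) ^ (l - 1)
      * csqrt (left_gf (1 - \<eta>) s) ^ (l + 1)"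
proof -
  have \<eta>: "0 \<le> \<eta>" "\<eta> \<le> 1" and \<eta>': "0 \<le> 1 - \<eta>" "1 - \<eta> \<le> 1"
    using rw p_walk_bounds[of M \<eta>] by (auto simp: random_walk_approx_def)
  define a where "a m = hit_prob \<eta> m (int l - 1)" for m
  define b where "b m k = stop_prob (1 - \<eta>) (\<lambda>c. c = 0) (\<lambda>c d. c - 1 + d) k (int m + int l + 1)" for m k
  define w where "w = csqrt (left_gf (1 - \<eta>) s)"
  have nonneg: "0 \<le> a m" "0 \<le> b m k" for m k
    using \<eta> \<eta>' by (simp_all add: a_def b_def stop_prob_nonneg)
  \<comment> \<open>Since \<open>norm (csqrt x) = sqrt (norm x)\<close>; the outer generating
    function is evaluated at \<open>w\<close> and must converge there.\<close>
  have w: "norm w \<le> 1"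
    using norm_stop_gf_le_1[OF \<eta>' s] by (simp add: w_def)
  have b_sum: "summable (b m)" "(\<Sum>k. b m k) \<le> 1" for m
  proof -
    show "summable (b m)"
      unfolding b_def by (rule summable_stop_prob[OF \<eta>'])
    then show "(\<Sum>k. b m k) \<le> 1"
      unfolding b_def using \<eta>'
      by (intro suminf_le_const sum_stop_prob_le[where h = "\<lambda>_. 1"]) auto
  qed
  \<comment> \<open>Each \<open>b m\<close> has mass at most 1, so \<open>a\<close> dominates; the
    nonnegative family \<open>a m * b m k\<close> in turn dominates the complex double
    series.\<close>
  have "(\<lambda>m. a m * (\<Sum>k. b m k)) summable_on UNIV"
  proof (subst summable_on_UNIV_nonneg_real_iff)
    show "summable (\<lambda>m. a m * (\<Sum>k. b m k))"
    proof (rule summable_comparison_test')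
      show "summable a"
        unfolding a_def by (rule summable_stop_prob[OF \<eta>])
      show "norm (a m * (\<Sum>k. b m k)) \<le> a m" for m
        using b_sum[of m] nonneg by (simp add: abs_mult suminf_nonneg mult_left_le)
    qed
  qed (use nonneg b_sum in \<open>intro mult_nonneg_nonneg suminf_nonneg\<close>)
  then have "(\<lambda>(m, k). a m * b m k) summable_on UNIV \<times> UNIV"
  proof (rule summable_on_SigmaI[rotated])
    fix m
    show "((\<lambda>k. case (m, k) of (m, k) \<Rightarrow> a m * b m k) has_sum a m * (\<Sum>k. b m k)) UNIV"
      using b_sum(1)[of m] nonneg
      by (simp add: norm_summable_imp_has_sum sums_mult summable_mult summable_sums abs_mult)
  qed (use nonneg in auto)
  then have "(\<lambda>x. norm (case x of (m, k) \<Rightarrow> of_real (a m * b m k) * s ^ k)) summable_on UNIV \<times> UNIV"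
  proof (rule Infinite_Sum.abs_summable_on_comparison_test')
    have "norm (of_real (a m * b m k) * s ^ k) \<le> a m * b m k" for m k
      using s nonneg by (simp add: norm_mult norm_power abs_mult mult_left_le power_le_one)
    then show "norm (case x of (m, k) \<Rightarrow> of_real (a m * b m k) * s ^ k) \<le> (case x of (m, k) \<Rightarrow> a m * b m k)"
      for x :: "nat \<times> nat"
      by (simp only: split_beta)
  qed
  from suminf_swap[OF Infinite_Sum.abs_summable_summable[OF this]]
  have swap: "(\<Sum>k. \<Sum>m. of_real (a m * b m k) * s ^ k) = (\<Sum>m. \<Sum>k. of_real (a m * b m k) * s ^ k)"
    by simp
  have P: "(\<lambda>m. a m * b m k) sums \<P>(\<omega> in M. stop_A2 A1 A2 \<omega> = enat k)" for k
    using prob_stop_A2[OF rw] by (simp add: a_def b_def)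
  have "(\<lambda>m. of_real (a m * b m k) * s ^ k) sums
      (of_real (\<P>(\<omega> in M. stop_A2 A1 A2 \<omega> = enat k)) * s ^ k)" for k
    by (intro sums_mult2 sums_of_real P)
  then have "G_II M A1 A2 s = (\<Sum>k. \<Sum>m. of_real (a m * b m k) * s ^ k)"
    by (simp add: G_II_def prob_gf_def sums_iff)
  also have "\<dots> = (\<Sum>m. of_real (a m) * count_gf (1 - \<eta>) (int m + int l + 1) s)"
    unfolding swap
  proof (intro suminf_cong)
    fix m
    have "summable (\<lambda>k. of_real (b m k) * s ^ k)"
      unfolding b_def by (rule summable_norm_cancel[OF summable_norm_stop_gf[OF \<eta>' s]])
    from suminf_mult[OF this, of "of_real (a m)"]
    show "(\<Sum>k. of_real (a m * b m k) * s ^ k)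
        = of_real (a m) * count_gf (1 - \<eta>) (int m + int l + 1) s"
      unfolding stop_gf_def b_def by (simp add: mult.assoc)
  qed
  also have "\<dots> = (\<Sum>m. w ^ (l + 1) * (of_real (a m) * w ^ m))"
  proof (intro suminf_cong)
    fix m
    show "of_real (a m) * count_gf (1 - \<eta>) (int m + int l + 1) s
        = w ^ (l + 1) * (of_real (a m) * w ^ m)"
    \<comment> \<open>For an even exponent \<open>w\<close> enters only through
      \<open>w\<^sup>2\<close>, matching \<open>count_gf_eq\<close>; an odd one is not covered by
      that lemma, but there \<open>a m = 0\<close>.\<close>
    proof (cases "even (m + l + 1)")
      case True
      then obtain n where n: "m + l + 1 = 2 * n" ..
      then have "int m + int l + 1 = 2 * int n" by linarith
      moreover have "left_gf (1 - \<eta>) s ^ n = w ^ (l + 1) * w ^ m"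
      proof -
        have "w ^ (l + 1) * w ^ m = (w\<^sup>2) ^ n"
          using n by (simp only: power_add[symmetric] power_mult[symmetric] ac_simps)
        then show ?thesis by (simp only: w_def power2_csqrt)
      qed
      ultimately show ?thesis
        by (simp add: count_gf_eq[OF \<eta>' s])
    next
      case False
      then have "odd (int l - 1 + int m)" by simp
      then have "a m = 0"
        unfolding a_def by (rule hit_prob_odd)
      then show ?thesis by simp
    qed
  qed
  also have "\<dots> = w ^ (l + 1) * hit_gf \<eta> (int (l - 1)) w"
    unfolding stop_gf_def a_def of_nat_diff[OF assms(1)] of_nat_1
    by (rule suminf_mult[OF summable_norm_cancel[OF summable_norm_stop_gf[OF \<eta> w]]])
  also have "\<dots> = w ^ (l + 1) * hit_gf \<eta> 1 w ^ (l - 1)"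
    by (simp only: hit_gf_power[OF \<eta> w])
  finally show ?thesis
    by (simp add: w_def mult.commute)
qed

theorem theorem9:
  fixes M :: "'a measure" and A1 A2 :: "nat \<Rightarrow> 'a \<Rightarrow> int"
    and \<eta> :: real and l :: nat and s :: complex
  assumes "1 \<le> l" and "0 \<le> \<eta>" and "\<eta> \<le> 1"
    and "random_walk_approx M \<eta> l A1 A2"
    and "norm s \<le> 1"
  shows "G_II M A1 A2 s =
           F_minus1 \<eta> (csqrt (H_left (1 - \<eta>) s)) ^ (l - 1) * csqrt (H_left (1 - \<eta>) s) ^ (l + 1)
       \<and> (\<forall>p::real. \<forall>z::complex. 0 \<le> p \<and> p \<le> 1 \<and> norm z \<le> 1 \<longrightarrow>
            F_minus1 p z =
              (if of_real p * z = 0 then z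
               else (1 - csqrt (1 - 4 * of_real p * (1 - of_real p) * z\<^sup>2)) / (2 * of_real p * z))
          \<and> H_left p z = ((1 - of_real p) * z) / (1 - of_real p * z))"
  using assms G_II_eq[OF assms(1,4,5)]
  by (simp add: F_minus1_eq H_left_eq hit_gf_1_eq left_gf_eq)

end
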